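(* For every integer $k\geq 2$, every universal graph for $\mathcal{P}_k$ has line-width at least $k+1$, where $\mathcal{P}_k$ is the class of graphs with path-width at most $k$.
   Context: All graphs (including universal graphs) are simple and countable (the vertex set is finite or countably infinite). A graph $U$ contains a graph $G$ if a subgraph (not necessarily induced) of $U$ is isomorphic to $G$. A graph $U$ is universal for a graph class $\mathcal{G}$ if $U$ contains every graph in $\mathcal{G}$ ($U$ need not be in $\mathcal{G}$). A line-decomposition of a graph $G$ is a pair $((L,\preccurlyeq),(B_t:t\in L))$ where $L$ is a non-empty set, $\preccurlyeq$ is a total order of $L$, and the bags $B_t\subseteq V(G)$ satisfy: $\bigcup_{t\in L}B_t=V(G)$; for each $vw\in E(G)$ there is $t\in L$ with $v,w\in B_t$; and $B_{t_1}\cap B_{t_3}\subseteq B_{t_2}$ for all $t_1\preccurlyeq t_2\preccurlyeq t_3$ in $L$. Its width is $\sup_{t\in L}(|B_t|-1)$. The line-width of $G$ is the minimum width of a line-decomposition of $G$. A path-decomposition is a line-decomposition with $(L,\preccurlyeq)=(\mathbb{N},\leq)$, and the path-width of $G$ is the minimum width of a path-decomposition of $G$. Widths may be $\infty$. *)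

theory Defs
  imports "HOL-Library.Extended_Real"
begin

record 'a graph =
  verts :: "'a set"
  edges :: "'a set set"

definition graph :: "'a graph \<Rightarrow> bool" where
  "graph G \<longleftrightarrow> countable (verts G) \<and> (\<forall>e \<in> edges G. e \<subseteq> verts G \<and> card e = 2)"

definition isomorphic :: "'a graph \<Rightarrow> 'b graph \<Rightarrow> bool" where
  "isomorphic G H \<longleftrightarrow>
     (\<exists>f. bij_betw f (verts G) (verts H) \<and> edges H = (\<lambda>e. f ` e) ` edges G)"

definition subgraph :: "'a graph \<Rightarrow> 'a graph \<Rightarrow> bool" where
  "subgraph H G \<longleftrightarrow> graph H \<and> verts H \<subseteq> verts G \<and> edges H \<subseteq> edges G"

definition contains :: "'a graph \<Rightarrow> 'b graph \<Rightarrow> bool" where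
  "contains U G \<longleftrightarrow> (\<exists>H. subgraph H U \<and> isomorphic G H)"

definition universal_graph :: "'a graph \<Rightarrow> 'b graph set \<Rightarrow> bool" where
  "universal_graph U \<G> \<longleftrightarrow> graph U \<and> (\<forall>G \<in> \<G>. contains U G)"

definition line_decomposition ::
    "'a graph \<Rightarrow> 'l set \<Rightarrow> 'l rel \<Rightarrow> ('l \<Rightarrow> 'a set) \<Rightarrow> bool" where
  "line_decomposition G L r B \<longleftrightarrow>
     L \<noteq> {} \<and> linear_order_on L r \<and>
     (\<Union>t \<in> L. B t) = verts G \<and>
     (\<forall>v w. {v, w} \<in> edges G \<longrightarrow> (\<exists>t \<in> L. v \<in> B t \<and> w \<in> B t)) \<and>
     (\<forall>t1 \<in> L. \<forall>t2 \<in> L. \<forall>t3 \<in> L.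
        (t1, t2) \<in> r \<longrightarrow> (t2, t3) \<in> r \<longrightarrow> B t1 \<inter> B t3 \<subseteq> B t2)"

definition ecard :: "'a set \<Rightarrow> ereal" where
  "ecard A = (if finite A then ereal (real (card A)) else \<infinity>)"

definition width :: "'l set \<Rightarrow> ('l \<Rightarrow> 'a set) \<Rightarrow> ereal" where
  "width L B = (SUP t \<in> L. ecard (B t) - 1)"

(* Widths lie in {-1, 0, 1, ..., \<infinity>}, which is well-ordered, and every graph has a decomposition
   with all bags equal to its vertex set, so the infima in line_width and path_width are
   attained: they are minima.

   HOL cannot quantify over index types inside a definition, so the type of the elements of the
   index set L is a parameter of line_width. A bound "c \<le> line_width TYPE('l) G" with 'l a free
   type variable says that every line-decomposition, over any index set whatsoever, has width
   at least c. *)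

definition line_width :: "'l itself \<Rightarrow> 'a graph \<Rightarrow> ereal" where
  "line_width _ G =
     Inf {width L B | (L :: 'l set) r B. line_decomposition G L r B}"

definition path_decomposition :: "'a graph \<Rightarrow> (nat \<Rightarrow> 'a set) \<Rightarrow> bool" where
  "path_decomposition G B \<longleftrightarrow> line_decomposition G UNIV {(i, j). i \<le> j} B"

definition path_width :: "'a graph \<Rightarrow> ereal" where
  "path_width G = Inf {width UNIV B | B. path_decomposition G B}"

(* Every countable graph is isomorphic to one whose vertices are natural numbers, so taking the
   vertices in nat represents the whole class up to isomorphism, which is all that
   universality depends on. *)
definition path_width_class :: "nat \<Rightarrow> nat graph set" where
  "path_width_class k = {G. graph G \<and> path_width G \<le> ereal (real k)}"

end

(* Sliding a window of k + 1 vertices along the naturals, where each step adds a new vertex and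
   drops either the smallest or the second smallest old one, yields for every 0-1 sequence s a
   graph of path-width at most k in which every window is a clique.  In a line-decomposition of
   width at most k the image of such a clique fills a whole bag.  Since the newest vertex is never
   the next one to be dropped (this needs k \<ge> 2), the bags of an embedded copy are visited
   monotonically, and the copy, including s, is determined by the image of the initial window
   and by the direction.  So a universal graph of line-width at most k would admit only
   countably many sequences s. *)

theory Submission
  imports Defs "HOL-Library.Countable_Set"
begin

section \<open>Sliding windows\<close>

definition drop_choice :: "bool \<Rightarrow> nat set \<Rightarrow> nat" where
  "drop_choice b A = (if b then Min A else Min (A - {Min A}))"

lemma
  assumes "card A \<ge> 2"
  shows drop_choice_in: "drop_choice b A \<in> A"
    and drop_choice_inject: "drop_choice b A = drop_choice c A \<Longrightarrow> b = c"
proof -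
  have fin: "finite A" and ne: "A \<noteq> {}"
    using assms by (auto intro: card_ge_0_finite)
  have "card (A - {Min A}) \<ge> 1"
    using assms Min_in[OF fin ne] by simp
  then have "A - {Min A} \<noteq> {}" by force
  then have "Min (A - {Min A}) \<in> A - {Min A}"
    using fin by (intro Min_in) auto
  then show "drop_choice b A \<in> A" and "drop_choice b A = drop_choice c A \<Longrightarrow> b = c"
    using Min_in[OF fin ne] by (auto simp: drop_choice_def split: if_splits)
qed

text \<open>Some element differs from both \<open>Min A\<close> and the dropped one, and it exceeds
  the latter. This is where k \<ge> 2 enters: windows have at least three elements, so the newest
  vertex survives the next step.\<close>

lemma drop_choice_less_Max:
  assumes "card A \<ge> 3"
  shows "drop_choice b A < Max A"
proof -
  let ?d = "drop_choice b A"
  have fin: "finite A" using assms by (auto intro: card_ge_0_finite)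
  have d: "?d \<in> A" by (rule drop_choice_in) (use assms in simp)
  have "card (A - {Min A, ?d}) \<ge> 1"
    using assms diff_card_le_card_Diff[of "{Min A, ?d}" A] card_insert_le_m1[of 2 "{?d}" "Min A"]
    by simp
  then have "A - {Min A, ?d} \<noteq> {}" by force
  then obtain y where y: "y \<in> A" "y \<noteq> Min A" "y \<noteq> ?d" by blast
  then have "?d \<le> y" using fin by (auto simp: drop_choice_def)
  with y have "?d < y" by simp
  also have "y \<le> Max A" using fin y by simp
  finally show ?thesis .
qed

fun window :: "nat \<Rightarrow> (nat \<Rightarrow> bool) \<Rightarrow> nat \<Rightarrow> nat set" where
  "window k s 0 = {..k}"
| "window k s (Suc i) = insert (k + Suc i) (window k s i - {drop_choice (s i) (window k s i)})"

lemma window_le: "v \<in> window k s i \<Longrightarrow> v \<le> k + i"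
  by (induction i) auto

lemma newest_in_window: "k + i \<in> window k s i"
  by (cases i) auto

lemma finite_window [simp]: "finite (window k s i)"
  by (induction i) auto

lemma card_window:
  assumes "k \<ge> 1"
  shows "card (window k s i) = k + 1"
proof (induction i)
  case (Suc i)
  have "drop_choice (s i) (window k s i) \<in> window k s i"
    by (rule drop_choice_in) (use Suc assms in simp)
  moreover have "k + Suc i \<notin> window k s i"
    using window_le by fastforce
  ultimately show ?case using Suc by simp
qed simp

lemma Max_window: "Max (window k s i) = k + i"
  by (rule Max_eqI) (auto intro: window_le newest_in_window)

lemma dropped_in_window:
  assumes "k \<ge> 2"
  shows "drop_choice (s i) (window k s i) \<in> window k s i"
  by (rule drop_choice_in) (use assms in \<open>simp add: card_window\<close>)

lemma dropped_less_newest: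
  assumes "k \<ge> 2"
  shows "drop_choice (s i) (window k s i) < k + i"
  using drop_choice_less_Max[of "window k s i" "s i"] assms by (simp add: card_window Max_window)

text \<open>After window \<open>i\<close> only vertices above \<open>k + i\<close> are inserted, so
  a vertex once dropped never returns. This makes the windows convex along the naturals.\<close>

lemma window_mono_backwards:
  "i \<le> j \<Longrightarrow> v \<le> k + i \<Longrightarrow> v \<in> window k s j \<Longrightarrow> v \<in> window k s i"
  by (induction rule: dec_induct) auto

section \<open>Path-width of the sliding graphs\<close>

definition sliding_graph :: "nat \<Rightarrow> (nat \<Rightarrow> bool) \<Rightarrow> nat graph" where
  "sliding_graph k s =
     \<lparr>verts = UNIV, edges = {{v, w} | v w i. v \<noteq> w \<and> v \<in> window k s i \<and> w \<in> window k s i}\<rparr>"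

lemma UN_window: "(\<Union>i. window k s i) = UNIV"
proof -
  have "v \<in> (\<Union>i. window k s i)" for v
  proof (cases "v \<le> k")
    case True
    then have "v \<in> window k s 0" by simp
    then show ?thesis by blast
  next
    case False
    then have "v \<in> window k s (v - k)" using newest_in_window[of k "v - k" s] by simp
    then show ?thesis by blast
  qed
  then show ?thesis by blast
qed

lemma sliding_graph_in_class:
  assumes "k \<ge> 2"
  shows "sliding_graph k s \<in> path_width_class k"
proof -
  have "path_decomposition (sliding_graph k s) (window k s)"
    unfolding path_decomposition_def line_decomposition_def
  proof (intro conjI ballI allI impI)
    show "linear_order_on UNIV {(i :: nat, j). i \<le> j}"
      by (auto simp: linear_order_on_def partial_order_on_def preorder_on_def refl_on_def
          trans_def antisym_def total_on_def)
    show "(\<Union>t. window k s t) = verts (sliding_graph k s)"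
      by (simp add: UN_window sliding_graph_def)
    show "\<exists>t\<in>UNIV. v \<in> window k s t \<and> w \<in> window k s t"
      if "{v, w} \<in> edges (sliding_graph k s)" for v w
      using that by (auto simp: sliding_graph_def doubleton_eq_iff)
    show "window k s h \<inter> window k s j \<subseteq> window k s i"
      if "(h, i) \<in> {(i, j). i \<le> j}" "(i, j) \<in> {(i, j). i \<le> j}" for h i j
      using that window_mono_backwards[of i j _ k s] window_le[of _ k s h] by fastforce
  qed simp
  then have "path_width (sliding_graph k s) \<le> width UNIV (window k s)"
    unfolding path_width_def by (blast intro: Inf_lower)
  also have "\<dots> \<le> ereal (real k)"
    using assms by (simp add: width_def ecard_def card_window one_ereal_def)
  finally show ?thesis
    by (auto simp: path_width_class_def graph_def sliding_graph_def)
qed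

section \<open>Cliques and window copies in line-decompositions\<close>

text \<open>Only the order and convexity of a decomposition are kept, so that reversing the order
  gives another instance and mirror-image arguments come for free.\<close>

locale convex_bags =
  fixes L :: "'l set" and r :: "'l rel" and B :: "'l \<Rightarrow> 'a set"
  assumes lin: "linear_order_on L r"
    and convex: "\<lbrakk>t1 \<in> L; t2 \<in> L; t3 \<in> L; (t1, t2) \<in> r; (t2, t3) \<in> r; v \<in> B t1; v \<in> B t3\<rbrakk>
      \<Longrightarrow> v \<in> B t2"
begin

lemma converse: "convex_bags L (r\<inverse>) B"
  using lin convex by unfold_locales auto

lemma linear: "x \<in> L \<Longrightarrow> y \<in> L \<Longrightarrow> (x, y) \<in> r \<or> (y, x) \<in> r"
  using lin by (metis linear_order_on_def partial_order_on_def preorder_on_def refl_onD total_on_def)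

lemma transD: "(x, y) \<in> r \<Longrightarrow> (y, z) \<in> r \<Longrightarrow> (x, z) \<in> r"
  using lin by (meson linear_order_on_def partial_order_on_def preorder_on_def transE)

lemma finite_least:
  "finite T \<Longrightarrow> T \<noteq> {} \<Longrightarrow> T \<subseteq> L \<Longrightarrow> \<exists>m\<in>T. \<forall>x\<in>T. (m, x) \<in> r"
proof (induction rule: finite_ne_induct)
  case (singleton x)
  then show ?case using linear by blast
next
  case (insert x F)
  then obtain m where "m \<in> F" "\<forall>y\<in>F. (m, y) \<in> r" by auto
  then show ?case using insert.prems linear[of x m] linear[of x x] transD[of x m] by blast
qed

text \<open>The leftmost of finitely many bags that \<open>v\<close> shares with the elements
  \<open>w\<close> of \<open>S\<close> lies between \<open>t\<close> and each of the others, so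
  convexity puts all of \<open>S\<close> into it.\<close>

lemma clique_extend_right:
  assumes "finite S" "S \<noteq> {}" "t \<in> L" "S \<subseteq> B t"
    and "\<And>w. w \<in> S \<Longrightarrow> \<exists>u\<in>L. (t, u) \<in> r \<and> v \<in> B u \<and> w \<in> B u"
  shows "\<exists>u\<in>L. insert v S \<subseteq> B u"
proof -
  obtain p where p: "\<And>w. w \<in> S \<Longrightarrow> p w \<in> L \<and> (t, p w) \<in> r \<and> v \<in> B (p w) \<and> w \<in> B (p w)"
    using assms(5) by metis
  obtain m where m: "m \<in> p ` S" "\<forall>x\<in>p ` S. (m, x) \<in> r"
    using finite_least[of "p ` S"] assms(1,2) p by blast
  then have "m \<in> L" "(t, m) \<in> r" "v \<in> B m" using p by auto
  moreover have "w \<in> B m" if "w \<in> S" for w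
    using convex[of t m "p w" w] that m p[of w] \<open>m \<in> L\<close> \<open>(t, m) \<in> r\<close> assms(3,4) by auto
  ultimately show ?thesis by blast
qed

text \<open>Helly property of intervals. The pairwise hypothesis includes v = w, which starts the
  induction.\<close>

lemma clique_in_bag:
  assumes "finite S" "S \<noteq> {}"
    and "\<And>v w. v \<in> S \<Longrightarrow> w \<in> S \<Longrightarrow> \<exists>t\<in>L. v \<in> B t \<and> w \<in> B t"
  shows "\<exists>t\<in>L. S \<subseteq> B t"
  using assms
proof (induction rule: finite_ne_induct)
  case (singleton x)
  then show ?case by auto
next
  case (insert v S)
  then obtain t where t: "t \<in> L" "S \<subseteq> B t" by auto
  interpret rev: convex_bags L "r\<inverse>" B by (rule converse)
  obtain p where p: "\<And>w. w \<in> S \<Longrightarrow> p w \<in> L \<and> v \<in> B (p w) \<and> w \<in> B (p w)"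
    using insert.prems by (metis insert_iff)
  \<comment> \<open>Bags containing \<open>v\<close> on both sides of \<open>t\<close> would force
    \<open>v\<close> into \<open>B t\<close> by convexity.\<close>
  consider "v \<in> B t" | "\<forall>w\<in>S. (t, p w) \<in> r" | "\<forall>w\<in>S. (p w, t) \<in> r"
    using linear[OF t(1)] p convex t(1) by meson
  then show ?case
  proof cases
    case 1
    then show ?thesis using t by blast
  next
    case 2
    then show ?thesis
      using clique_extend_right[OF insert.hyps(1,2) t] p by blast
  next
    case 3
    then show ?thesis
      using rev.clique_extend_right[OF insert.hyps(1,2) t] p by blast
  qed
qed

text \<open>Two moves leave the same bag \<open>A\<close>, and \<open>t1\<close> comes no later than
  \<open>u1\<close>. Since \<open>a\<close> is gone at \<open>t1\<close>, it cannot be in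
  \<open>u1\<close>, so both moves drop it. The lookahead bag \<open>t2\<close> has lost
  \<open>c\<close> but still has \<open>x\<close>: the loss places it after \<open>u1\<close>, and
  then \<open>x\<close> lies in \<open>u1\<close> by convexity.\<close>

lemma step_unique:
  assumes L: "t0 \<in> L" "t1 \<in> L" "t2 \<in> L" "u1 \<in> L"
    and r: "(t0, t1) \<in> r" "(t1, t2) \<in> r" "(t1, u1) \<in> r"
    and t0: "B t0 = A" and t1: "B t1 = insert x (A - {a})"
    and u1: "B u1 = insert y (A - {b})"
    and "a \<in> A" "x \<notin> A" "x \<in> B t2"
    and c: "c \<in> A" "c \<noteq> a" "c \<notin> B t2"
  shows "a = b \<and> x = y"
proof -
  have "a \<notin> B t1" using assms by auto
  then have ab: "a = b"
    using convex[of t0 t1 u1 a] L r t0 u1 \<open>a \<in> A\<close> by auto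
  \<comment> \<open>\<open>c\<close> lies in the bags at \<open>t1\<close> and \<open>u1\<close> but
    not at \<open>t2\<close>.\<close>
  have "(t2, u1) \<notin> r"
    using convex[of t1 t2 u1 c] L r c t1 u1 ab by auto
  then have "(u1, t2) \<in> r" using linear L by blast
  then have "x \<in> B u1"
    using convex[of t1 u1 t2 x] L r t1 \<open>x \<in> B t2\<close> by auto
  then show ?thesis using u1 \<open>x \<notin> A\<close> ab by auto
qed

end

section \<open>Rigidity of window copies\<close>

locale window_copy = convex_bags L r B
  for L :: "'l set" and r and B :: "'l \<Rightarrow> 'a set" +
  fixes k :: nat and s :: "nat \<Rightarrow> bool" and f :: "nat \<Rightarrow> 'a" and t :: "nat \<Rightarrow> 'l"
  assumes k: "k \<ge> 2"
    and inj: "inj f"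
    and tL: "t i \<in> L"
    and bag: "B (t i) = f ` window k s i"
begin

abbreviation dropped :: "nat \<Rightarrow> nat" where
  "dropped i \<equiv> drop_choice (s i) (window k s i)"

lemma bag_iff: "f v \<in> B (t i) \<longleftrightarrow> v \<in> window k s i"
  using inj by (auto simp: bag inj_def)

lemma bag_Suc: "B (t (Suc i)) = insert (f (k + Suc i)) (B (t i) - {f (dropped i)})"
  using inj by (simp add: bag image_set_diff)

lemma dropped_bag: "f (dropped i) \<in> B (t i)" "f (dropped i) \<notin> B (t (Suc i))"
  using dropped_in_window[OF k, of s i] dropped_less_newest[OF k, of s i] by (auto simp: bag_iff)

lemma newest_bag: "f (k + Suc i) \<in> B (t (Suc i))" "f (k + Suc i) \<notin> B (t i)"
  using window_le[of "k + Suc i" k s i] by (auto simp: bag_iff)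

lemma newest_stays: "f (k + Suc i) \<in> B (t (Suc (Suc i)))"
  using newest_in_window[of k "Suc i" s] dropped_less_newest[OF k, of s "Suc i"]
  unfolding bag_iff by (subst window.simps) auto

text \<open>The vertex dropped next is not the newest one, so it is already in the current window.
  It serves as the witness \<open>c\<close> in \<open>step_unique\<close>.\<close>

lemma dropped_Suc_old: "f (dropped (Suc i)) \<in> B (t i)" "f (dropped (Suc i)) \<noteq> f (dropped i)"
proof -
  have "dropped (Suc i) \<in> window k s (Suc i)" "dropped (Suc i) < k + Suc i"
    using dropped_in_window[OF k] dropped_less_newest[OF k] by blast+
  then have "dropped (Suc i) \<in> window k s i - {dropped i}"
    by (metis insertE less_irrefl window.simps(2))
  then show "f (dropped (Suc i)) \<in> B (t i)" "f (dropped (Suc i)) \<noteq> f (dropped i)"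
    using inj unfolding bag_iff by (auto dest: injD)
qed

text \<open>If the third bag turned back, it would lie either between the first two, which share the
  vertex it has just dropped, or before both, and then the first bag would have to contain the
  vertex newly added in the second.\<close>

lemma direction_persists:
  assumes "(t i, t (Suc i)) \<in> r"
  shows "(t (Suc i), t (Suc (Suc i))) \<in> r"
proof (rule ccontr)
  assume "\<not> ?thesis"
  then have backwards: "(t (Suc (Suc i)), t (Suc i)) \<in> r"
    using linear tL by blast
  have "(t i, t (Suc (Suc i))) \<notin> r"
    using convex[OF tL tL tL _ backwards dropped_Suc_old(1) dropped_bag(1)] dropped_bag(2) by blast
  then have "(t (Suc (Suc i)), t i) \<in> r"
    using linear tL by blast
  then show False
    using convex[OF tL tL tL _ assms newest_stays newest_bag(1)] newest_bag(2) by blast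
qed

lemma monotone:
  assumes "(t 0, t (Suc 0)) \<in> r"
  shows "(t i, t (Suc i)) \<in> r"
  by (induction i) (use assms direction_persists in auto)

end

text \<open>Both copies move rightwards from equal bags. Whichever next bag comes first,
  \<open>step_unique\<close>, with roles swapped if necessary, forces the same dropped and added
  vertices. Induction then determines the windows, and these determine the bits.\<close>

lemma window_copy_unique:
  assumes "window_copy L r B k s f t" and "window_copy L r B k s' g u"
    and "(t 0, t (Suc 0)) \<in> r" and "(u 0, u (Suc 0)) \<in> r"
    and init: "\<And>v. v \<le> k \<Longrightarrow> f v = g v"
  shows "s = s'"
proof -
  interpret F: window_copy L r B k s f t by fact
  interpret G: window_copy L r B k s' g u by fact
  have step: "F.dropped i = G.dropped i \<and> f (k + Suc i) = g (k + Suc i)"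
    if same: "window k s i = window k s' i" and fg: "\<And>v. v \<le> k + i \<Longrightarrow> f v = g v" for i
  proof -
    \<comment> \<open>The indices \<open>t i\<close> and \<open>u i\<close> may differ; only the
      bags as sets matter.\<close>
    have bags: "B (t i) = B (u i)"
      unfolding F.bag G.bag same using fg window_le[of _ k s' i] by (intro image_cong) auto
    have "f (F.dropped i) = g (G.dropped i) \<and> f (k + Suc i) = g (k + Suc i)"
    proof (cases "(t (Suc i), u (Suc i)) \<in> r")
      case True
      show ?thesis
        by (rule F.step_unique[OF F.tL[of i] F.tL[of "Suc i"] F.tL[of "Suc (Suc i)"]
              G.tL[of "Suc i"] F.monotone F.monotone True refl F.bag_Suc
              G.bag_Suc[of i, folded bags] F.dropped_bag(1) F.newest_bag(2) F.newest_stays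
              F.dropped_Suc_old F.dropped_bag(2)]) fact+
    next
      case False
      then have "(u (Suc i), t (Suc i)) \<in> r" using F.linear F.tL G.tL by blast
      note swapped = F.step_unique[OF G.tL[of i] G.tL[of "Suc i"] G.tL[of "Suc (Suc i)"]
          F.tL[of "Suc i"] G.monotone G.monotone this refl G.bag_Suc
          F.bag_Suc[of i, unfolded bags] G.dropped_bag(1) G.newest_bag(2) G.newest_stays
          G.dropped_Suc_old G.dropped_bag(2)]
      have "g (G.dropped i) = f (F.dropped i) \<and> g (k + Suc i) = f (k + Suc i)"
        by (rule swapped) fact+
      then show ?thesis by simp
    qed
    \<comment> \<open>In this range \<open>f\<close> and \<open>g\<close> agree, so injectivity of
      \<open>g\<close> turns equal images into equal dropped vertices.\<close>
    moreover have "F.dropped i \<le> k + i"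
      using dropped_less_newest[OF F.k, of s i] by simp
    ultimately show ?thesis using fg G.inj by (auto dest: injD)
  qed
  have agree: "window k s i = window k s' i \<and> (\<forall>v\<le>k + i. f v = g v)" for i
  proof (induction i)
    case 0
    then show ?case using init by simp
  next
    case (Suc i)
    then show ?case using step[of i] by (auto simp: le_Suc_eq)
  qed
  have "s i = s' i" for i
  proof (rule drop_choice_inject)
    show "drop_choice (s i) (window k s i) = drop_choice (s' i) (window k s i)"
      using step[of i] agree[of i] by simp
    show "card (window k s i) \<ge> 2"
      using F.k by (simp add: card_window)
  qed
  then show ?thesis by blast
qed

section \<open>Counting embeddings\<close>

lemma uncountable_nat_bool: "uncountable (UNIV :: (nat \<Rightarrow> bool) set)"
proof
  assume "countable (UNIV :: (nat \<Rightarrow> bool) set)"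
  then have surj: "range (from_nat_into (UNIV :: (nat \<Rightarrow> bool) set)) = UNIV"
    by (intro range_from_nat_into) auto
  \<comment> \<open>Cantor's diagonal sequence.\<close>
  obtain n where "from_nat_into UNIV n = (\<lambda>n. \<not> from_nat_into UNIV n n)"
    using surj by (metis surjD)
  then show False by metis
qed

lemma contains_sliding_graph:
  fixes U :: "'a graph"
  assumes "contains U (sliding_graph k s)"
  obtains f where "inj f" "range f \<subseteq> verts U"
    "\<And>v w i. \<lbrakk>v \<noteq> w; v \<in> window k s i; w \<in> window k s i\<rbrakk> \<Longrightarrow> {f v, f w} \<in> edges U"
proof -
  obtain H :: "'a graph" and f where H: "verts H \<subseteq> verts U" "edges H \<subseteq> edges U"
    and "bij_betw f (verts (sliding_graph k s)) (verts H)"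
    and edges: "edges H = (\<lambda>e. f ` e) ` edges (sliding_graph k s)"
    using assms unfolding contains_def subgraph_def isomorphic_def by meson
  then have f: "bij_betw f UNIV (verts H)" by (simp add: sliding_graph_def)
  show thesis
  proof (rule that)
    show "inj f" "range f \<subseteq> verts U"
      using f H(1) by (auto simp: bij_betw_def)
    show "{f v, f w} \<in> edges U" if "v \<noteq> w" "v \<in> window k s i" "w \<in> window k s i" for v w i
    proof -
      have "{v, w} \<in> edges (sliding_graph k s)"
        using that by (auto simp: sliding_graph_def)
      then have "f ` {v, w} \<in> edges H"
        unfolding edges by (rule imageI)
      then show ?thesis using H(2) by auto
    qed
  qed
qed

text \<open>The image of a window is a clique of \<open>k + 1\<close> vertices, so some bag contains
  it, and the size bound leaves no room for anything else in that bag.\<close>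

lemma window_copy_exists:
  assumes dec: "line_decomposition U L r B" and k: "k \<ge> 2"
    and small: "\<And>t. t \<in> L \<Longrightarrow> finite (B t) \<and> card (B t) \<le> k + 1"
    and "contains U (sliding_graph k s)"
  shows "\<exists>f t. window_copy L r B k s f t \<and> range f \<subseteq> verts U"
proof -
  interpret convex_bags L r B
  proof
    show "linear_order_on L r"
      using dec by (simp add: line_decomposition_def)
    show "v \<in> B t2"
      if "t1 \<in> L" "t2 \<in> L" "t3 \<in> L" "(t1, t2) \<in> r" "(t2, t3) \<in> r" "v \<in> B t1" "v \<in> B t3"
      for t1 t2 t3 v
      using dec that unfolding line_decomposition_def by (meson IntI subsetD)
  qed
  obtain f where f: "inj f" "range f \<subseteq> verts U"
    "\<And>v w i. \<lbrakk>v \<noteq> w; v \<in> window k s i; w \<in> window k s i\<rbrakk> \<Longrightarrow> {f v, f w} \<in> edges U"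
    using contains_sliding_graph[OF assms(4)] by blast
  have "\<exists>t\<in>L. B t = f ` window k s i" for i
  proof -
    have "\<exists>t\<in>L. f ` window k s i \<subseteq> B t"
    proof (rule clique_in_bag)
      show "f ` window k s i \<noteq> {}" using newest_in_window by blast
      fix x y assume "x \<in> f ` window k s i" "y \<in> f ` window k s i"
      then obtain v w where vw: "v \<in> window k s i" "w \<in> window k s i" "x = f v" "y = f w"
        by blast
      show "\<exists>t\<in>L. x \<in> B t \<and> y \<in> B t"
      proof (cases "v = w")
        case True
        have "x \<in> (\<Union>t\<in>L. B t)"
          using dec f(2) vw by (auto simp: line_decomposition_def)
        then show ?thesis using True vw by auto
      next
        case False
        then show ?thesis
          using f(3)[OF False vw(1,2)] dec vw unfolding line_decomposition_def by blast
      qed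
    qed simp
    then obtain t where t: "t \<in> L" "f ` window k s i \<subseteq> B t" by blast
    moreover have "card (f ` window k s i) = k + 1"
      using f(1) k by (subst card_image) (auto simp: card_window intro: inj_on_subset)
    ultimately have "f ` window k s i = B t"
      using small[OF t(1)] by (intro card_seteq) auto
    then show ?thesis using t(1) by auto
  qed
  then obtain t where "\<And>i. t i \<in> L \<and> B (t i) = f ` window k s i" by metis
  then have "window_copy L r B k s f t"
    using f(1) k by unfold_locales auto
  then show ?thesis using f(2) by blast
qed

theorem theorem6:
  fixes k :: nat and U :: "'a graph"
  assumes "k \<ge> 2"
    and "universal_graph U (path_width_class k)"
  shows "line_width TYPE('l) U \<ge> ereal (real (k + 1))"
proof (rule ccontr)
  assume "\<not> ?thesis"
  then obtain L :: "'l set" and r B where dec: "line_decomposition U L r B"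
    and wd: "width L B < ereal (real (k + 1))"
    by (auto simp: line_width_def not_le Inf_less_iff)
  \<comment> \<open>Width below \<open>k + 1\<close> means width at most \<open>k\<close>, that is,
    bags of size at most \<open>k + 1\<close>.\<close>
  have small: "finite (B t) \<and> card (B t) \<le> k + 1" if "t \<in> L" for t
  proof -
    have "ecard (B t) - 1 \<le> width L B"
      unfolding width_def using that by (rule SUP_upper)
    then have "ecard (B t) - 1 < ereal (real (k + 1))"
      using wd by (rule le_less_trans)
    then show ?thesis
      by (auto simp: ecard_def one_ereal_def split: if_splits)
  qed
  have U: "countable (verts U)" "\<And>s. contains U (sliding_graph k s)"
    using assms sliding_graph_in_class by (auto simp: universal_graph_def graph_def)
  obtain f t where copy: "\<And>s. window_copy L r B k s (f s) (t s)"
    and range: "\<And>s. range (f s) \<subseteq> verts U"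
    using window_copy_exists[OF dec assms(1) small U(2)] by metis
  \<comment> \<open>The image of the initial window, in order, and the direction of the first move:
    the data that determine \<open>s\<close>.\<close>
  define code where "code s = (map (f s) [0..<Suc k], (t s 0, t s (Suc 0)) \<in> r)" for s
  have "inj code"
  proof (rule injI)
    fix s s' assume eq: "code s = code s'"
    have init: "f s v = f s' v" if "v \<le> k" for v
      using eq that by (auto simp: code_def simp del: upt_Suc)
    interpret F: window_copy L r B k s "f s" "t s" by (rule copy)
    interpret G: window_copy L r B k s' "f s'" "t s'" by (rule copy)
    \<comment> \<open>Leftward copies become rightward ones when the order is reversed.\<close>
    have reverse: "window_copy L (r\<inverse>) B k z (f z) (t z)" if "window_copy L r B k z (f z) (t z)" for z
      using that F.converse unfolding window_copy_def by blast
    show "s = s'"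
    proof (cases "(t s 0, t s (Suc 0)) \<in> r")
      case True
      then show ?thesis
        using eq by (intro window_copy_unique[OF copy copy _ _ init]) (auto simp: code_def)
    next
      case False
      \<comment> \<open>Equal codes give both copies the same direction, so one reversal serves
        both.\<close>
      then have "(t s 0, t s (Suc 0)) \<in> r\<inverse>" "(t s' 0, t s' (Suc 0)) \<in> r\<inverse>"
        using eq F.linear F.tL G.tL unfolding code_def by blast+
      then show ?thesis
        by (rule window_copy_unique[OF reverse[OF copy] reverse[OF copy] _ _ init])
    qed
  qed
  moreover have "countable (range code)"
  proof (rule countable_subset)
    show "range code \<subseteq> lists (verts U) \<times> UNIV"
      using range by (auto simp: code_def image_subset_iff simp del: upt_Suc)
    show "countable (lists (verts U) \<times> (UNIV :: bool set))"
      using U(1) by (intro countable_SIGMA countable_lists) auto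
  qed
  ultimately show False
    using uncountable_nat_bool countable_image_inj_on by blast
qed

end
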